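(* Let $G=(V,E)$ be an undirected weighted graph, $T\subseteq V$ a terminal set, $S\subseteq T$ with $|S|\ge 2|T|/3$, and $s,\delta,\gamma>0$. Suppose $V$ is $(s,\delta,\gamma,S)$-terminal-strong in $G$. Let $\kappa=\min\{\gamma/(2s),\gamma/6\}$. Let $G'$ be obtained from $G$ by adding a source $\sigma$ with an edge of capacity $\delta\kappa$ to each terminal in $S$ and a sink $\tau$ with an edge of capacity $\delta\kappa$ from each terminal in $T\setminus S$; let $(U',\overline{U'})$ be a minimum $\sigma$–$\tau$ cut in $G'$ with $\sigma\in U'$, and set $U=U'\setminus\{\sigma\}$, $\overline U=\overline{U'}\setminus\{\tau\}$. Then $|U\cap T|\ge|T|/3$ and $U$ is $(\max\{2/\kappa+s,3s\},\ \delta,\ \kappa,\ U\cap T)$-terminal-strong in $G$.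
   Context: For $X\subseteq V$, $\partial X$ is the set of edges with exactly one endpoint in $X$, $\overline X=V\setminus X$, and $\partial_{G[U]}C$ is the set of edges with both endpoints in $U$ and exactly one endpoint in $C$. A Steiner cut is a cut $(C,\overline C)$ such that both sides contain a vertex of $T$. For $X\subseteq T$, a set $U\subseteq V$ is $(s,\delta,\gamma,X)$-terminal-strong in $G$ if every Steiner cut $(C,\overline C)$ of $G$ with $w(\partial C)\le\delta$ satisfies $\min\{|C\cap U\cap X|,|\overline C\cap U\cap X|\}\le s$, and moreover, if $|C\cap U\cap X|>0$ and $|\overline C\cap U\cap X|>0$, then $w(\partial_{G[U]}C)\ge\gamma\cdot\delta$. *)

theory Defs
  imports Complex_Main
begin

text \<open>
  An undirected edge is the two-element set of its endpoints, so there are no loops, and parallel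
  edges are represented by a single edge carrying their total weight.
\<close>

record 'v wgraph =
  verts :: "'v set"
  edges :: "'v set set"
  weight :: "'v set \<Rightarrow> real"

definition weighted_graph :: "'v wgraph \<Rightarrow> bool" where
  "weighted_graph G \<longleftrightarrow>
     finite (verts G) \<and>
     (\<forall>e\<in>edges G. e \<subseteq> verts G \<and> card e = 2) \<and>
     (\<forall>e\<in>edges G. weight G e \<ge> 0)"

definition induced_subgraph :: "'v wgraph \<Rightarrow> 'v set \<Rightarrow> 'v wgraph" where
  "induced_subgraph G U =
     \<lparr> verts = verts G \<inter> U, edges = {e \<in> edges G. e \<subseteq> U}, weight = weight G \<rparr>"

text \<open>
  The set \<open>X\<close> need not consist of vertices of \<open>G\<close>; in particular
  \<open>boundary (induced_subgraph G U) C\<close> makes sense for any vertex set \<open>C\<close> of \<open>G\<close>.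
\<close>

definition boundary :: "'v wgraph \<Rightarrow> 'v set \<Rightarrow> 'v set set" where
  "boundary G X = {e \<in> edges G. card (e \<inter> X) = 1}"

definition cut_weight :: "'v wgraph \<Rightarrow> 'v set \<Rightarrow> real" where
  "cut_weight G X = (\<Sum>e\<in>boundary G X. weight G e)"

text \<open>A cut is given by one of its sides \<open>C\<close>; the other side is \<open>verts G - C\<close>.\<close>

definition steiner_cut :: "'v wgraph \<Rightarrow> 'v set \<Rightarrow> 'v set \<Rightarrow> bool" where
  "steiner_cut G T C \<longleftrightarrow>
     C \<subseteq> verts G \<and> C \<inter> T \<noteq> {} \<and> (verts G - C) \<inter> T \<noteq> {}"

definition terminal_strong ::
  "'v wgraph \<Rightarrow> 'v set \<Rightarrow> real \<Rightarrow> real \<Rightarrow> real \<Rightarrow> 'v set \<Rightarrow> 'v set \<Rightarrow> bool" where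
  "terminal_strong G T s \<delta> \<gamma> X U \<longleftrightarrow>
     X \<subseteq> T \<and> U \<subseteq> verts G \<and>
     (\<forall>C. steiner_cut G T C \<and> cut_weight G C \<le> \<delta> \<longrightarrow>
        min (real (card (C \<inter> U \<inter> X))) (real (card ((verts G - C) \<inter> U \<inter> X))) \<le> s \<and>
        (card (C \<inter> U \<inter> X) > 0 \<and> card ((verts G - C) \<inter> U \<inter> X) > 0 \<longrightarrow>
           cut_weight (induced_subgraph G U) C \<ge> \<gamma> * \<delta>))"

text \<open>
  Intended for distinct \<open>\<sigma>\<close>, \<open>\<tau>\<close> outside \<open>verts G\<close>. The new edges can be taken undirected: as none
  of them enters \<open>\<sigma>\<close> or leaves \<open>\<tau>\<close>, their contribution to a \<open>\<sigma>\<close>-\<open>\<tau>\<close> cut does not depend on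
  the orientation.
\<close>

definition add_source_sink ::
  "'v wgraph \<Rightarrow> 'v \<Rightarrow> 'v \<Rightarrow> 'v set \<Rightarrow> 'v set \<Rightarrow> real \<Rightarrow> 'v wgraph" where
  "add_source_sink G \<sigma> \<tau> A B c =
     \<lparr> verts = verts G \<union> {\<sigma>, \<tau>},
       edges = edges G \<union> {{\<sigma>, t} | t. t \<in> A} \<union> {{t, \<tau>} | t. t \<in> B},
       weight = (\<lambda>e. if \<sigma> \<in> e \<or> \<tau> \<in> e then c else weight G e) \<rparr>"

definition st_cut :: "'v wgraph \<Rightarrow> 'v \<Rightarrow> 'v \<Rightarrow> 'v set \<Rightarrow> bool" where
  "st_cut G \<sigma> \<tau> C \<longleftrightarrow> C \<subseteq> verts G \<and> \<sigma> \<in> C \<and> \<tau> \<in> verts G - C"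

definition min_st_cut :: "'v wgraph \<Rightarrow> 'v \<Rightarrow> 'v \<Rightarrow> 'v set \<Rightarrow> bool" where
  "min_st_cut G \<sigma> \<tau> C \<longleftrightarrow>
     st_cut G \<sigma> \<tau> C \<and> (\<forall>D. st_cut G \<sigma> \<tau> D \<longrightarrow> cut_weight G C \<le> cut_weight G D)"

end

theory Submission
  imports Defs
begin

text \<open>
  With \<open>c = \<delta>\<kappa>\<close>, minimality of \<open>U'\<close> says that \<open>U\<close> minimises
  \<open>f D = w(\<partial>D) + c |S - D| + c |D \<inter> (T - S)|\<close> over all vertex sets \<open>D\<close>. Comparing with \<open>D = V\<close>
  gives the size of \<open>U \<inter> T\<close>. Now let \<open>C\<close> be a Steiner cut of weight at most \<open>\<delta>\<close>, oriented so that
  \<open>|C \<inter> S| \<le> s\<close>, and compare \<open>U\<close> with \<open>U - C\<close>. Since \<open>w(\<partial>(U - C)) \<le> w(\<partial>U) + \<delta>\<close>, at most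
  \<open>1/\<kappa> + s\<close> vertices of \<open>T - S\<close> lie in \<open>U \<inter> C\<close>, so \<open>|U \<inter> C \<inter> T| \<le> 1/\<kappa> + 2s\<close>. More precisely,
  \<open>w(\<partial>(U \<inter> C)) + w(\<partial>(U - C)) = w(\<partial>U) + 2 x\<close> with \<open>x\<close> the weight of \<open>C\<close> in \<open>G[U]\<close>, hence
  \<open>w(\<partial>(U \<inter> C)) \<le> 2 x + c |U \<inter> C \<inter> S| - c |U \<inter> C \<inter> (T - S)|\<close>. If \<open>U \<inter> C\<close> misses \<open>S\<close>, this
  gives \<open>x \<ge> c\<close> because \<open>w(\<partial>(U \<inter> C)) \<ge> x\<close>. Otherwise the strength hypothesis for the cut \<open>C\<close>
  forces \<open>\<gamma> \<le> 1\<close>, and for the Steiner cut \<open>U \<inter> C\<close> it then yields \<open>w(\<partial>(U \<inter> C)) \<ge> \<gamma>\<delta>\<close>, so that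
  \<open>2 x \<ge> \<gamma>\<delta> - c s \<ge> \<gamma>\<delta>/2 \<ge> 3 c\<close>.
\<close>

section \<open>Cut weights as sums over edges\<close>

lemma weighted_graph_finite_edges:
  assumes "weighted_graph G"
  shows "finite (edges G)"
proof (rule finite_subset)
  show "edges G \<subseteq> Pow (verts G)" "finite (Pow (verts G))"
    using assms by (auto simp: weighted_graph_def)
qed

lemma weighted_graph_edge_cases:
  assumes "weighted_graph G" "e \<in> edges G"
  obtains x y where "e = {x, y}" "x \<noteq> y" "x \<in> verts G" "y \<in> verts G"
  using assms by (auto simp: weighted_graph_def card_2_iff)

lemma card_doubleton_Int_eq_1_iff:
  assumes "x \<noteq> y"
  shows "card ({x, y} \<inter> X) = 1 \<longleftrightarrow> (x \<in> X) \<noteq> (y \<in> X)"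
  using assms by (cases "x \<in> X"; cases "y \<in> X") auto

lemma weighted_graph_induced_subgraph:
  "weighted_graph G \<Longrightarrow> weighted_graph (induced_subgraph G U)"
  by (auto simp: weighted_graph_def induced_subgraph_def)

lemma cut_weight_alt:
  assumes "weighted_graph G"
  shows "cut_weight G X = (\<Sum>e\<in>edges G. if card (e \<inter> X) = 1 then weight G e else 0)"
  using weighted_graph_finite_edges[OF assms]
  by (simp add: cut_weight_def boundary_def sum.inter_filter)

lemma cut_weight_induced_subgraph:
  assumes "weighted_graph G"
  shows "cut_weight (induced_subgraph G U) X =
    (\<Sum>e\<in>edges G. if e \<subseteq> U \<and> card (e \<inter> X) = 1 then weight G e else 0)"
proof -
  have "boundary (induced_subgraph G U) X = {e \<in> edges G. e \<subseteq> U \<and> card (e \<inter> X) = 1}"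
    by (auto simp: boundary_def induced_subgraph_def)
  then show ?thesis
    using weighted_graph_finite_edges[OF assms]
    by (simp add: cut_weight_def sum.inter_filter induced_subgraph_def)
qed

lemma cut_weight_nonneg: "weighted_graph G \<Longrightarrow> cut_weight G X \<ge> 0"
  by (auto simp: cut_weight_def boundary_def weighted_graph_def intro!: sum_nonneg)

text \<open>The larger set \<open>V\<close> is there for induced subgraphs: the complement of
  \<open>C\<close> is taken in \<open>verts G\<close>, also when the graph is
  \<open>induced_subgraph G U\<close>.\<close>

lemma cut_weight_compl:
  assumes "weighted_graph G" "verts G \<subseteq> V"
  shows "cut_weight G (V - X) = cut_weight G X"
  unfolding cut_weight_alt[OF assms(1)]
proof (rule sum.cong[OF refl])
  fix e assume "e \<in> edges G"
  then obtain x y where "e = {x, y}" "x \<noteq> y" "x \<in> verts G" "y \<in> verts G"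
    using weighted_graph_edge_cases assms(1) by metis
  then show "(if card (e \<inter> (V - X)) = 1 then weight G e else 0) =
      (if card (e \<inter> X) = 1 then weight G e else 0)"
    using assms(2) by (auto simp: card_doubleton_Int_eq_1_iff[unfolded One_nat_def])
qed

text \<open>Edge by edge: if \<open>X\<close> and \<open>Y\<close> both fail to separate the ends of
  an edge, so does \<open>X - Y\<close>.\<close>

lemma cut_weight_Diff_le:
  assumes "weighted_graph G"
  shows "cut_weight G (X - Y) \<le> cut_weight G X + cut_weight G Y"
  unfolding cut_weight_alt[OF assms] sum.distrib[symmetric]
proof (rule sum_mono)
  fix e assume e: "e \<in> edges G"
  then obtain x y where "e = {x, y}" "x \<noteq> y"
    using weighted_graph_edge_cases assms by metis
  moreover have "weight G e \<ge> 0" using assms e by (simp add: weighted_graph_def)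
  ultimately show "(if card (e \<inter> (X - Y)) = 1 then weight G e else 0) \<le>
      (if card (e \<inter> X) = 1 then weight G e else 0) +
      (if card (e \<inter> Y) = 1 then weight G e else 0)"
    by (auto simp: card_doubleton_Int_eq_1_iff[unfolded One_nat_def])
qed

text \<open>An edge leaving \<open>U\<close> has its end in \<open>U\<close> in exactly one of the
  two pieces, so it counts once on each side. An edge inside \<open>U\<close> that \<open>C\<close>
  cuts lies in the boundary of both pieces, hence the factor 2.\<close>

lemma cut_weight_Int_Diff:
  assumes "weighted_graph G"
  shows "cut_weight G (U \<inter> C) + cut_weight G (U - C) =
    cut_weight G U + 2 * cut_weight (induced_subgraph G U) C"
  unfolding cut_weight_alt[OF assms] cut_weight_induced_subgraph[OF assms]
    sum_distrib_left sum.distrib[symmetric]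
proof (rule sum.cong[OF refl])
  fix e assume "e \<in> edges G"
  then obtain x y where "e = {x, y}" "x \<noteq> y"
    using weighted_graph_edge_cases assms by metis
  then show "(if card (e \<inter> (U \<inter> C)) = 1 then weight G e else 0) +
      (if card (e \<inter> (U - C)) = 1 then weight G e else 0) =
      (if card (e \<inter> U) = 1 then weight G e else 0) +
      2 * (if e \<subseteq> U \<and> card (e \<inter> C) = 1 then weight G e else 0)"
    by (auto simp: card_doubleton_Int_eq_1_iff[unfolded One_nat_def])
qed

lemma cut_weight_induced_le:
  assumes "weighted_graph G"
  shows "cut_weight (induced_subgraph G U) C \<le> cut_weight G (U \<inter> C)"
  unfolding cut_weight_alt[OF assms] cut_weight_induced_subgraph[OF assms]
proof (rule sum_mono)
  fix e assume e: "e \<in> edges G"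
  then obtain x y where "e = {x, y}" "x \<noteq> y"
    using weighted_graph_edge_cases assms by metis
  moreover have "weight G e \<ge> 0" using assms e by (simp add: weighted_graph_def)
  ultimately show "(if e \<subseteq> U \<and> card (e \<inter> C) = 1 then weight G e else 0) \<le>
      (if card (e \<inter> (U \<inter> C)) = 1 then weight G e else 0)"
    by (auto simp: card_doubleton_Int_eq_1_iff[unfolded One_nat_def])
qed

lemma steiner_cut_compl:
  "steiner_cut G T C \<Longrightarrow> steiner_cut G T (verts G - C)"
  by (auto simp: steiner_cut_def)

section \<open>Cuts in the network with source and sink\<close>

lemma cut_weight_add_source_sink:
  assumes G: "weighted_graph G" and AB: "A \<subseteq> verts G" "B \<subseteq> verts G"
    and st: "\<sigma> \<notin> verts G" "\<tau> \<notin> verts G" "\<sigma> \<noteq> \<tau>" and D: "D \<subseteq> verts G"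
  shows "cut_weight (add_source_sink G \<sigma> \<tau> A B c) (insert \<sigma> D) =
    cut_weight G D + c * real (card (A - D)) + c * real (card (D \<inter> B))"
proof -
  let ?H = "add_source_sink G \<sigma> \<tau> A B c"
  let ?a = "\<lambda>t. {\<sigma>, t}" and ?b = "\<lambda>t. {t, \<tau>}"
  have fin: "finite (verts G)" using G by (simp add: weighted_graph_def)
  have finAB: "finite (A - D)" "finite (D \<inter> B)"
    using fin AB D by (auto intro: finite_subset)
  have finb: "finite (boundary G D)"
    using weighted_graph_finite_edges[OF G] by (simp add: boundary_def)
  have sub: "e \<subseteq> verts G" if "e \<in> edges G" for e
    using G that by (simp add: weighted_graph_def)
  have old: "e \<inter> insert \<sigma> D = e \<inter> D" if "e \<in> edges G" for e
    using sub[OF that] st by auto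
  have a: "card (?a t \<inter> insert \<sigma> D) = 1 \<longleftrightarrow> t \<notin> D" if "t \<in> A" for t
    using that AB st by (subst card_doubleton_Int_eq_1_iff) auto
  have b: "card (?b t \<inter> insert \<sigma> D) = 1 \<longleftrightarrow> t \<in> D" if "t \<in> B" for t
    using that AB st D by (subst card_doubleton_Int_eq_1_iff) auto
  have edges: "edges ?H = edges G \<union> ?a ` A \<union> ?b ` B"
    by (auto simp: add_source_sink_def)
  have bd: "boundary ?H (insert \<sigma> D) = boundary G D \<union> ?a ` (A - D) \<union> ?b ` (D \<inter> B)"
  proof (rule set_eqI)
    fix e
    have "e \<in> boundary ?H (insert \<sigma> D) \<longleftrightarrow>
      (e \<in> edges G \<and> card (e \<inter> insert \<sigma> D) = 1) \<or>
      (\<exists>t\<in>A. e = ?a t \<and> card (?a t \<inter> insert \<sigma> D) = 1) \<or>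
      (\<exists>t\<in>B. e = ?b t \<and> card (?b t \<inter> insert \<sigma> D) = 1)"
      unfolding boundary_def edges by blast
    also have "\<dots> \<longleftrightarrow> (e \<in> edges G \<and> card (e \<inter> D) = 1) \<or>
      (\<exists>t\<in>A. e = ?a t \<and> t \<notin> D) \<or> (\<exists>t\<in>B. e = ?b t \<and> t \<in> D)"
      by (simp only: a b old cong: conj_cong bex_cong)
    also have "\<dots> \<longleftrightarrow> e \<in> boundary G D \<union> ?a ` (A - D) \<union> ?b ` (D \<inter> B)"
      unfolding boundary_def by blast
    finally show "e \<in> boundary ?H (insert \<sigma> D) \<longleftrightarrow>
      e \<in> boundary G D \<union> ?a ` (A - D) \<union> ?b ` (D \<inter> B)" .
  qed
  \<comment> \<open>Edges of \<open>G\<close> avoid both new vertices, so they are distinct from the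
    new edges and keep their weight.\<close>
  have noG: "\<sigma> \<notin> e \<and> \<tau> \<notin> e" if "e \<in> boundary G D" for e
    using that sub st by (auto simp: boundary_def)
  have disj: "boundary G D \<inter> ?a ` (A - D) = {}"
    "(boundary G D \<union> ?a ` (A - D)) \<inter> ?b ` (D \<inter> B) = {}"
    using noG st AB D by (auto simp: doubleton_eq_iff)
  have inj: "inj_on ?a (A - D)" "inj_on ?b (D \<inter> B)"
    by (auto simp: inj_on_def doubleton_eq_iff)
  have w: "weight ?H e = (if \<sigma> \<in> e \<or> \<tau> \<in> e then c else weight G e)" for e
    by (simp add: add_source_sink_def)
  have "cut_weight ?H (insert \<sigma> D) = sum (weight ?H) (boundary G D) +
      sum (weight ?H) (?a ` (A - D)) + sum (weight ?H) (?b ` (D \<inter> B))"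
    unfolding cut_weight_def bd using finb finAB disj by (simp add: sum.union_disjoint)
  also have "sum (weight ?H) (boundary G D) = cut_weight G D"
    unfolding cut_weight_def by (rule sum.cong) (auto simp: w noG)
  also have "sum (weight ?H) (?a ` (A - D)) = c * real (card (A - D))"
    by (subst sum.reindex[OF inj(1)]) (simp add: w)
  also have "sum (weight ?H) (?b ` (D \<inter> B)) = c * real (card (D \<inter> B))"
    by (subst sum.reindex[OF inj(2)]) (simp add: w)
  finally show ?thesis .
qed

section \<open>Consequences of minimality\<close>

lemma minimal_set_Diff_bound:
  assumes G: "weighted_graph G" and T: "T \<subseteq> verts G" and S: "S \<subseteq> T" and U: "U \<subseteq> verts G"
    and min: "\<And>D. D \<subseteq> verts G \<Longrightarrow>
      cut_weight G U + c * real (card (S - U)) + c * real (card (U \<inter> (T - S))) \<le>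
      cut_weight G D + c * real (card (S - D)) + c * real (card (D \<inter> (T - S)))"
  shows "cut_weight G U + c * real (card (U \<inter> C \<inter> (T - S))) \<le>
    cut_weight G (U - C) + c * real (card (U \<inter> C \<inter> S))"
proof -
  have fin: "finite S" "finite T" "finite U"
    using G T S U by (auto simp: weighted_graph_def intro: finite_subset)
  \<comment> \<open>Passing from \<open>U\<close> to \<open>U - C\<close> adds the source edges at
    \<open>U \<inter> C \<inter> S\<close> to the cut and removes the sink edges at
    \<open>U \<inter> C \<inter> (T - S)\<close>; all other new edges cancel.\<close>
  have "S - (U - C) = (S - U) \<union> (U \<inter> C \<inter> S)" "(S - U) \<inter> (U \<inter> C \<inter> S) = {}"
    by auto
  then have 1: "card (S - (U - C)) = card (S - U) + card (U \<inter> C \<inter> S)"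
    using fin by (metis card_Un_disjoint finite_Diff finite_Int)
  have "U \<inter> (T - S) = ((U - C) \<inter> (T - S)) \<union> (U \<inter> C \<inter> (T - S))"
    "((U - C) \<inter> (T - S)) \<inter> (U \<inter> C \<inter> (T - S)) = {}"
    by auto
  then have 2: "card (U \<inter> (T - S)) = card ((U - C) \<inter> (T - S)) + card (U \<inter> C \<inter> (T - S))"
    using fin by (metis card_Un_disjoint finite_Diff finite_Int)
  have "U - C \<subseteq> verts G" using U by auto
  from min[OF this] show ?thesis unfolding 1 2 by (simp add: distrib_left)
qed

lemma minimal_set_card_bound:
  assumes G: "weighted_graph G" and T: "T \<subseteq> verts G" and S: "S \<subseteq> T"
    and pos: "\<delta> > 0" "\<kappa> > 0"
    and bound: "cut_weight G U + \<delta> * \<kappa> * real (card (U \<inter> C \<inter> (T - S))) \<le>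
      cut_weight G (U - C) + \<delta> * \<kappa> * real (card (U \<inter> C \<inter> S))"
    and C: "cut_weight G C \<le> \<delta>" "real (card (C \<inter> S)) \<le> s"
  shows "real (card (C \<inter> U \<inter> T)) \<le> max (2 / \<kappa> + s) (3 * s)"
proof -
  have fin: "finite T" "finite S"
    using G T S by (auto simp: weighted_graph_def intro: finite_subset)
  have aS: "real (card (U \<inter> C \<inter> S)) \<le> s"
    using C(2) card_mono[of "C \<inter> S" "U \<inter> C \<inter> S"] fin by force
  have "C \<inter> U \<inter> T = (U \<inter> C \<inter> S) \<union> (U \<inter> C \<inter> (T - S))" using S by auto
  then have split: "card (C \<inter> U \<inter> T) \<le> card (U \<inter> C \<inter> S) + card (U \<inter> C \<inter> (T - S))"
    by (metis card_Un_le)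
  have "\<delta> * \<kappa> * real (card (U \<inter> C \<inter> (T - S))) \<le> \<delta> + \<delta> * \<kappa> * real (card (U \<inter> C \<inter> S))"
    using bound cut_weight_Diff_le[OF G, of U C] C(1) by linarith
  also have "\<dots> \<le> \<delta> + \<delta> * \<kappa> * s"
    using aS pos by simp
  also have "\<dots> = \<delta> * \<kappa> * (1 / \<kappa> + s)"
    using pos by (simp add: field_simps)
  finally have "real (card (U \<inter> C \<inter> (T - S))) \<le> 1 / \<kappa> + s"
    using pos by simp
  then have "real (card (C \<inter> U \<inter> T)) \<le> 1 / \<kappa> + 2 * s"
    using split aS by linarith
  \<comment> \<open>If \<open>1 / \<kappa> \<le> s\<close>, the bound is at most
    \<open>3 * s\<close>; otherwise one \<open>s\<close> is replaced by \<open>1 / \<kappa>\<close>,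
    giving \<open>2 / \<kappa> + s\<close>.\<close>
  then show ?thesis
    by (cases "1 / \<kappa> \<le> s") (auto simp: max_def)
qed

text \<open>\<open>C\<close> stands for whichever side contains few vertices of \<open>S\<close>.
  Demanding that the other side meets \<open>S\<close> makes the strength hypothesis applicable to
  \<open>C\<close> and to \<open>U \<inter> C\<close> as soon as \<open>U \<inter> C\<close> meets
  \<open>S\<close>.\<close>

lemma minimal_set_strength:
  assumes G: "weighted_graph G" and T: "T \<subseteq> verts G" and S: "S \<subseteq> T" and U: "U \<subseteq> verts G"
    and pos: "s > 0" "\<delta> > 0" "\<gamma> > 0"
    and strong: "terminal_strong G T s \<delta> \<gamma> S (verts G)"
    and \<kappa>: "\<kappa> = min (\<gamma> / (2 * s)) (\<gamma> / 6)"
    and bound: "cut_weight G U + \<delta> * \<kappa> * real (card (U \<inter> C \<inter> (T - S))) \<le>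
      cut_weight G (U - C) + \<delta> * \<kappa> * real (card (U \<inter> C \<inter> S))"
    and C: "steiner_cut G T C" "cut_weight G C \<le> \<delta>" "real (card (C \<inter> S)) \<le> s"
    and ne: "C \<inter> U \<inter> T \<noteq> {}" "(verts G - C) \<inter> S \<noteq> {}"
  shows "cut_weight (induced_subgraph G U) C \<ge> \<kappa> * \<delta>"
proof -
  let ?x = "cut_weight (induced_subgraph G U) C"
  let ?A = "U \<inter> C"
  have fin: "finite T" "finite S"
    using G T S by (auto simp: weighted_graph_def intro: finite_subset)
  have \<kappa>pos: "\<kappa> > 0" using \<kappa> pos by simp
  have le: "cut_weight G ?A \<le>
      2 * ?x + \<delta> * \<kappa> * real (card (?A \<inter> S)) - \<delta> * \<kappa> * real (card (?A \<inter> (T - S)))"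
    using bound cut_weight_Int_Diff[OF G, of U C] by linarith
  show ?thesis
  proof (cases "?A \<inter> S = {}")
    case True
    then have "?A \<inter> (T - S) \<noteq> {}" using ne by blast
    then have "card (?A \<inter> (T - S)) \<ge> 1"
      using fin by (simp add: Suc_le_eq card_gt_0_iff)
    then have "\<delta> * \<kappa> * 1 \<le> \<delta> * \<kappa> * real (card (?A \<inter> (T - S)))"
      using pos \<kappa>pos by (intro mult_left_mono) auto
    moreover have "real (card (?A \<inter> S)) = 0" unfolding True by simp
    ultimately show ?thesis
      using le cut_weight_induced_le[OF G, of U C] by (simp add: mult.commute)
  next
    case False
    have strongD: "\<gamma> * \<delta> \<le> cut_weight G D"
      if D: "steiner_cut G T D" "cut_weight G D \<le> \<delta>" "D \<inter> S \<noteq> {}" "(verts G - D) \<inter> S \<noteq> {}" for D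
    proof -
      have edges: "edges (induced_subgraph G (verts G)) = edges G"
        "weight (induced_subgraph G (verts G)) = weight G"
        using G by (auto simp: induced_subgraph_def weighted_graph_def)
      have eq: "cut_weight (induced_subgraph G (verts G)) D = cut_weight G D"
        "D \<inter> verts G \<inter> S = D \<inter> S" "(verts G - D) \<inter> verts G \<inter> S = (verts G - D) \<inter> S"
        using D(1) by (auto simp: cut_weight_def boundary_def edges steiner_cut_def)
      have "card (D \<inter> S) > 0" "card ((verts G - D) \<inter> S) > 0"
        using D fin by (auto simp: card_gt_0_iff)
      then show ?thesis
        using strong D(1,2) eq unfolding terminal_strong_def by metis
    qed
    have "\<gamma> * \<delta> \<le> cut_weight G C"
      using False ne C by (intro strongD) auto
    then have \<gamma>: "\<gamma> * \<delta> \<le> \<delta>" using C(2) by linarith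
    have A: "steiner_cut G T ?A" "?A \<inter> S \<noteq> {}" "(verts G - ?A) \<inter> S \<noteq> {}"
      using False ne C(1) U S by (auto simp: steiner_cut_def)
    \<comment> \<open>The strength hypothesis covers only cuts of weight at most
      \<open>\<delta>\<close>; for heavier ones \<open>\<gamma> * \<delta> \<le> \<delta>\<close>
      suffices.\<close>
    have 1: "\<gamma> * \<delta> \<le> cut_weight G ?A"
      using strongD[OF A(1) _ A(2,3)] \<gamma> by (cases "cut_weight G ?A \<le> \<delta>") auto
    have "real (card (?A \<inter> S)) \<le> s"
      using C(3) card_mono[of "C \<inter> S" "?A \<inter> S"] fin by force
    then have "\<delta> * \<kappa> * real (card (?A \<inter> S)) \<le> \<delta> * (\<kappa> * s)"
      using pos \<kappa>pos by simp
    also have "\<kappa> * s \<le> \<gamma> / (2 * s) * s"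
      using \<kappa> pos by (intro mult_right_mono) auto
    then have "\<delta> * (\<kappa> * s) \<le> \<delta> * (\<gamma> / 2)"
      using pos by (intro mult_left_mono) auto
    finally have 2: "\<delta> * \<kappa> * real (card (?A \<inter> S)) \<le> \<delta> * (\<gamma> / 2)" .
    have 3: "\<delta> * \<kappa> * real (card (?A \<inter> (T - S))) \<ge> 0"
      using pos \<kappa>pos by simp
    have "\<kappa> \<le> \<gamma> / 6" using \<kappa> by simp
    then have 4: "\<delta> * \<kappa> \<le> \<delta> * (\<gamma> / 6)" using pos by (intro mult_left_mono) auto
    have "\<delta> * \<kappa> > 0" using pos \<kappa>pos by simp
    with le 1 2 3 4 show ?thesis by (simp add: algebra_simps)
  qed
qed

section \<open>Size and strength of the minimum cut side\<close>

theorem theorem4p9: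
  fixes G G' :: "'v wgraph"
    and T S U U' :: "'v set"
    and \<sigma> \<tau> :: 'v
    and s \<delta> \<gamma> \<kappa> :: real
  assumes "weighted_graph G"
    and "T \<subseteq> verts G"
    and "S \<subseteq> T"
    and "real (card S) \<ge> 2 * real (card T) / 3"
    and "s > 0" and "\<delta> > 0" and "\<gamma> > 0"
    and "terminal_strong G T s \<delta> \<gamma> S (verts G)"
    and "\<kappa> = min (\<gamma> / (2 * s)) (\<gamma> / 6)"
    and "\<sigma> \<notin> verts G" and "\<tau> \<notin> verts G" and "\<sigma> \<noteq> \<tau>"
    and "G' = add_source_sink G \<sigma> \<tau> S (T - S) (\<delta> * \<kappa>)"
    and "min_st_cut G' \<sigma> \<tau> U'"
    and "U = U' - {\<sigma>}"
  shows "real (card (U \<inter> T)) \<ge> real (card T) / 3 \<and>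
         terminal_strong G T (max (2 / \<kappa> + s) (3 * s)) \<delta> \<kappa> (U \<inter> T) U"
proof -
  note G = assms(1) and T = assms(2) and S = assms(3) and st = assms(10-12)
  have fin: "finite T" "finite S"
    using G T S by (auto simp: weighted_graph_def intro: finite_subset)
  have \<kappa>pos: "\<kappa> > 0" using assms by simp
  have U: "U \<subseteq> verts G" and U': "U' = insert \<sigma> U"
    using assms(13-15) by (auto simp: min_st_cut_def st_cut_def add_source_sink_def)
  let ?f = "\<lambda>D. cut_weight G D + \<delta> * \<kappa> * real (card (S - D)) + \<delta> * \<kappa> * real (card (D \<inter> (T - S)))"
  \<comment> \<open>This turns minimality among source-sink cuts into minimality of
    \<open>?f\<close> among all vertex sets of \<open>G\<close>.\<close>
  have f: "cut_weight G' (insert \<sigma> D) = ?f D" if "D \<subseteq> verts G" for D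
    unfolding assms(13) using T S that by (intro cut_weight_add_source_sink[OF G _ _ st]) auto
  have min: "?f U \<le> ?f D" if D: "D \<subseteq> verts G" for D
  proof -
    have "st_cut G' \<sigma> \<tau> (insert \<sigma> D)"
      using D st by (auto simp: st_cut_def assms(13) add_source_sink_def)
    then have "cut_weight G' U' \<le> cut_weight G' (insert \<sigma> D)"
      using assms(14) by (simp add: min_st_cut_def)
    then show ?thesis by (simp add: U' f[OF U] f[OF D])
  qed
  have "real (card (U \<inter> T)) \<ge> real (card T) / 3"
  proof -
    \<comment> \<open>For \<open>D = verts G\<close> only the sink edges are cut, so
      \<open>|S - U| \<le> |T - S|\<close>. Hence
      \<open>|U \<inter> T| \<ge> |S| - |T - S| = 2|S| - |T| \<ge> |T|/3\<close>.\<close>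
    have "cut_weight G (verts G) = 0"
      using cut_weight_compl[OF G subset_refl, of "{}"] by (simp add: cut_weight_def boundary_def)
    moreover have "card (S - verts G) = 0" "verts G \<inter> (T - S) = T - S"
      using T S by (auto simp: Diff_eq_empty_iff[THEN iffD2])
    ultimately have "?f U \<le> \<delta> * \<kappa> * real (card (T - S))"
      using min[OF subset_refl] by simp
    moreover have "\<delta> * \<kappa> * real (card (U \<inter> (T - S))) \<ge> 0"
      using \<open>\<delta> > 0\<close> \<kappa>pos by simp
    ultimately have "\<delta> * \<kappa> * real (card (S - U)) \<le> \<delta> * \<kappa> * real (card (T - S))"
      using cut_weight_nonneg[OF G, of U] by linarith
    then have "card (S - U) \<le> card (T - S)"
      using \<open>\<delta> > 0\<close> \<kappa>pos by simp
    moreover have "card (T - S) = card T - card S" "card S \<le> card T"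
      using fin S by (auto simp: card_Diff_subset card_mono)
    moreover have "card S = card (S - U) + card (U \<inter> S)"
      using fin by (metis Int_commute add.commute card_Int_Diff)
    moreover have "card (U \<inter> S) \<le> card (U \<inter> T)"
      using fin S by (intro card_mono) auto
    ultimately show ?thesis using assms(4) by linarith
  qed
  moreover have "terminal_strong G T (max (2 / \<kappa> + s) (3 * s)) \<delta> \<kappa> (U \<inter> T) U"
    unfolding terminal_strong_def
  proof (intro conjI allI impI)
    fix C assume "steiner_cut G T C \<and> cut_weight G C \<le> \<delta>"
    then have C: "steiner_cut G T C" "cut_weight G C \<le> \<delta>" by auto
    \<comment> \<open>Either side may be the one with at most \<open>s\<close> vertices of
      \<open>S\<close>, so the bounds are prepared for both.\<close>
    let ?C' = "verts G - C"
    have C': "steiner_cut G T ?C'" "cut_weight G ?C' \<le> \<delta>"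
      using C steiner_cut_compl cut_weight_compl[OF G subset_refl] by auto
    have CV: "C \<subseteq> verts G" using C(1) by (simp add: steiner_cut_def)
    then have C'': "verts G - ?C' = C" by auto
    have eq: "D \<inter> U \<inter> (U \<inter> T) = D \<inter> U \<inter> T" for D by auto
    note bound = minimal_set_Diff_bound[OF G T S U min]
    have "min (real (card (C \<inter> verts G \<inter> S))) (real (card (?C' \<inter> verts G \<inter> S))) \<le> s"
      using assms(8) C by (simp add: terminal_strong_def)
    moreover have "C \<inter> verts G \<inter> S = C \<inter> S" "?C' \<inter> verts G \<inter> S = ?C' \<inter> S"
      using CV by auto
    ultimately have small: "real (card (C \<inter> S)) \<le> s \<or> real (card (?C' \<inter> S)) \<le> s"
      by (simp add: min_le_iff_disj)
    show "min (real (card (C \<inter> U \<inter> (U \<inter> T)))) (real (card (?C' \<inter> U \<inter> (U \<inter> T))))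
        \<le> max (2 / \<kappa> + s) (3 * s)"
      using small minimal_set_card_bound[OF G T S \<open>\<delta> > 0\<close> \<kappa>pos bound]
        C(2) C'(2) unfolding eq min_le_iff_disj by blast
    assume "0 < card (C \<inter> U \<inter> (U \<inter> T)) \<and> 0 < card (?C' \<inter> U \<inter> (U \<inter> T))"
    then have ne: "C \<inter> U \<inter> T \<noteq> {}" "?C' \<inter> U \<inter> T \<noteq> {}"
      unfolding eq by (auto simp: card_gt_0_iff)
    have sym: "cut_weight (induced_subgraph G U) ?C' = cut_weight (induced_subgraph G U) C"
      by (intro cut_weight_compl weighted_graph_induced_subgraph G)
        (simp add: induced_subgraph_def)
    have strength: "\<kappa> * \<delta> \<le> cut_weight (induced_subgraph G U) D"
      if "steiner_cut G T D" "cut_weight G D \<le> \<delta>" "real (card (D \<inter> S)) \<le> s"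
        "D \<inter> U \<inter> T \<noteq> {}" "(verts G - D) \<inter> S \<noteq> {}" for D
      using minimal_set_strength[OF G T S U assms(5-9) bound that] .
    show "\<kappa> * \<delta> \<le> cut_weight (induced_subgraph G U) C"
    proof (cases "C \<inter> S = {} \<or> ?C' \<inter> S = {}")
      case False
      then show ?thesis
        using small strength[OF C] strength[OF C'] ne sym C'' by metis
    next
      case True
      \<comment> \<open>The side missing \<open>S\<close> has \<open>0 \<le> s\<close> vertices of
        \<open>S\<close> and can play the small side, provided that the other side meets
        \<open>S\<close>. It does, since an empty \<open>S\<close> would force \<open>T\<close> to
        be empty by \<open>|S| \<ge> 2|T|/3\<close>.\<close>
      have "C \<inter> S \<noteq> {} \<or> ?C' \<inter> S \<noteq> {}"
      proof (rule ccontr)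
        assume "\<not> ?thesis"
        then have "S = {}" using T S by auto
        then have "T = {}" using assms(4) fin by simp
        then show False using ne by simp
      qed
      with True show ?thesis
        using strength[OF C] strength[OF C'] ne sym C'' \<open>s > 0\<close>
        by (metis card.empty less_imp_le of_nat_0)
    qed
  qed (use U in auto)
  ultimately show ?thesis by blast
qed

end
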